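(* Let $n,t,p\in\mathbb{N}$ with $1\le t<n$ and $p\ge 1$. 1) Let $a_1=\cdots=a_t=n-t$, $a_{t+1}=\cdots=a_{2t}=2(n-t)$, $\ldots$, $a_{(p-1)t+1}=\cdots=a_{pt}=p(n-t)$ (that is, $a_i=k(n-t)$ for $(k-1)t<i\le kt$, $k\in[p]$). Then $$\begin{bmatrix} n\\ t\end{bmatrix}_p=\det_{1\le i,j\le pt}\left(\binom{a_i+1}{j-i+1}\right).$$ 2) Let $a'_1=\cdots=a'_{n-t}=t$, $a'_{n-t+1}=\cdots=a'_{2(n-t)}=2t$, $\ldots$, $a'_{(p-1)(n-t)+1}=\cdots=a'_{p(n-t)}=pt$ (that is, $a'_i=kt$ for $(k-1)(n-t)<i\le k(n-t)$, $k\in[p]$). Then $$\begin{bmatrix} n\\ n-t\end{bmatrix}_p=\det_{1\le i,j\le p(n-t)}\left(\binom{a'_i+1}{j-i+1}\right).$$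
   Context: $\mathbb{N}$ is the set of nonnegative integers, and $[m]=\{1,\ldots,m\}$ (with $[0]=\emptyset$). For $n,t,p\in\mathbb{N}$ with $1\le t<n$, $p\ge1$, $\begin{bmatrix} n\\ t\end{bmatrix}_p$ denotes the number of elements of $$A(n,t,p)=\Big\{\alpha\in\mathbb{N}^{pt+1} \ \Big|\ \sum_{i=1}^{pt+1}\alpha_i=p(n-t),\ \sum_{i=1}^{kt}\alpha_i\le k(n-t)\ \text{for all } k\in[p-1]\Big\}.$$ Binomial coefficients $\binom{a}{b}$ with $a\ge0$ are $0$ when $b<0$ or $b>a$. *)

theory Defs
  imports "Jordan_Normal_Form.Determinant" "HOL-Library.FuncSet"
begin

text \<open>Vectors in \<open>\<nat>\<^sup>m\<close> are functions on \<open>{1..m}\<close>, extended by \<open>undefined\<close> outside, so that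
  each vector is represented exactly once. Subtraction on \<^typ>\<open>nat\<close> is truncated; the definition
  is meant for \<open>1 \<le> t < n\<close> and \<open>p \<ge> 1\<close>.\<close>

definition bracket_set :: "nat \<Rightarrow> nat \<Rightarrow> nat \<Rightarrow> (nat \<Rightarrow> nat) set" where
  "bracket_set n t p =
     {\<alpha> \<in> {1..p * t + 1} \<rightarrow>\<^sub>E (UNIV :: nat set).
        (\<Sum>i = 1..p * t + 1. \<alpha> i) = p * (n - t) \<and>
        (\<forall>k \<in> {1..p - 1}. (\<Sum>i = 1..k * t. \<alpha> i) \<le> k * (n - t))}"

lemma finite_bracket_set: "finite (bracket_set n t p)"
proof (rule finite_subset)
  show "bracket_set n t p \<subseteq> {1..p * t + 1} \<rightarrow>\<^sub>E {..p * (n - t)}"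
  proof
    fix \<alpha> assume *: "\<alpha> \<in> bracket_set n t p"
    have "\<alpha> i \<le> p * (n - t)" if "i \<in> {1..p * t + 1}" for i
    proof -
      have "\<alpha> i \<le> (\<Sum>i = 1..p * t + 1. \<alpha> i)"
        using that by (intro member_le_sum) auto
      then show ?thesis using * by (simp add: bracket_set_def)
    qed
    moreover have "\<alpha> \<in> extensional {1..p * t + 1}"
      using * unfolding bracket_set_def PiE_def by blast
    ultimately show "\<alpha> \<in> {1..p * t + 1} \<rightarrow>\<^sub>E {..p * (n - t)}"
      by (auto simp: PiE_def)
  qed
qed (intro finite_PiE; simp)

definition bracket :: "nat \<Rightarrow> nat \<Rightarrow> nat \<Rightarrow> nat" where
  "bracket n t p = card (bracket_set n t p)"

text \<open>Binomial coefficients with an integer lower index, zero if that index is negative.\<close>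

definition binom :: "nat \<Rightarrow> int \<Rightarrow> int" where
  "binom a b = (if b < 0 then 0 else int (a choose nat b))"

text \<open>The determinant of \<open>(f i j)\<close> for \<open>1 \<le> i, j \<le> m\<close>; \<^const>\<open>mat\<close> indexes from 0.\<close>

definition det1 :: "nat \<Rightarrow> (nat \<Rightarrow> nat \<Rightarrow> int) \<Rightarrow> int" where
  "det1 m f = det (mat m m (\<lambda>(i, j). f (i + 1) (j + 1)))"

end

theory Submission
  imports Defs
begin

text \<open>The partial sums of the elements of \<open>A(n, t, p)\<close> are the weakly increasing sequences
  \<open>s\<^sub>1 \<le> \<dots> \<le> s\<^sub>N\<close> with \<open>N = p t\<close> and \<open>s\<^sub>i \<le> a\<^sub>i\<close>. For weakly increasing \<open>a\<close> let \<open>f\<^sub>k\<close> be the number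
  of such sequences of length \<open>k\<close>, and let \<open>Y\<^sub>i\<close> count the sequences \<open>s\<^sub>1 \<le> \<dots> \<le> s\<^sub>i > s\<^sub>i\<^sub>+\<^sub>1 > \<dots> > s\<^sub>N\<close>
  whose first \<open>i\<close> terms respect the bounds. Comparing \<open>s\<^sub>i\<^sub>-\<^sub>1\<close> with \<open>s\<^sub>i\<close> gives
  \<open>(a\<^sub>i + 1 choose N - i + 1) f\<^sub>i\<^sub>-\<^sub>1 = Y\<^sub>i + Y\<^sub>i\<^sub>-\<^sub>1\<close>, and the alternating sum telescopes to
  \<open>f\<^sub>N = \<Sum>\<^sub>i (-1)\<^bsup>N - i\<^esup> (a\<^sub>i + 1 choose N - i + 1) f\<^sub>i\<^sub>-\<^sub>1\<close>, which is the recursion satisfied by the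
  leading principal minors of the Hessenberg matrix in question.\<close>

section \<open>Hessenberg determinants\<close>

text \<open>Up to sign, \<open>fSuc\<close> says that the row vector \<open>(-1) ^ i * f i\<close>
  annihilates every column but the last. Expanding along that row leaves \<open>f N\<close> times a
  unitriangular minor.\<close>

lemma det_hessenberg:
  fixes h :: "nat \<Rightarrow> nat \<Rightarrow> 'a :: idom" and f :: "nat \<Rightarrow> 'a"
  assumes sub: "\<And>j. h (Suc j) j = 1"
    and zero: "\<And>i j. Suc j < i \<Longrightarrow> h i j = 0"
    and f0: "f 0 = 1"
    and fSuc: "\<And>j. f (Suc j) = (\<Sum>i\<le>j. (-1) ^ (j - i) * h i j * f i)"
  shows "det (mat N N (\<lambda>(i, j). h i j)) = f N"
proof (cases N)
  case 0
  then show ?thesis by (simp add: f0)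
next
  case (Suc M)
  define H where "H = mat N N (\<lambda>(i, j). h i j)"
  \<comment> \<open>Multiplying by \<open>U\<close> replaces the first row of \<open>H\<close> by \<open>(0, \<dots>, 0, (-1)\<^bsup>N - 1\<^esup> f\<^sub>N)\<close>.\<close>
  define U where "U = mat N N (\<lambda>(i, j). if i = 0 then (-1) ^ j * f j else if i = j then 1 else 0)"
  have H: "H \<in> carrier_mat N N" and U: "U \<in> carrier_mat N N"
    by (auto simp: H_def U_def)
  have "upper_triangular U"
    by (auto simp: U_def upper_triangular_def)
  then have "det U = prod_list (diag_mat U)"
    using U by (rule det_upper_triangular)
  also have "\<dots> = 1"
    unfolding prod_list_diag_prod by (rule prod.neutral) (simp add: U_def f0)
  finally have detU: "det U = 1" .
  have row0: "(U * H) $$ (0, j) = (if j = M then (-1) ^ M * f N else 0)" if j: "j < N" for j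
  proof -
    have "(U * H) $$ (0, j) = (\<Sum>i<N. (-1) ^ i * f i * h i j)"
      using j by (simp add: U_def H_def scalar_prod_def atLeast0LessThan)
    also have "\<dots> = (\<Sum>i<N. if i \<le> Suc j then (-1) ^ i * f i * h i j else 0)"
      by (rule sum.cong) (auto simp: zero)
    \<comment> \<open>Row \<open>Suc j\<close> exists in every column but the last. Its term there
      cancels the rest of the sum, so only column \<open>M\<close> survives.\<close>
    also have "\<dots> = (\<Sum>i\<in>{..<N} \<inter> {..Suc j}. (-1) ^ i * f i * h i j)"
      by (simp add: sum.inter_restrict)
    finally have eq: "(U * H) $$ (0, j) = (\<Sum>i\<in>{..<N} \<inter> {..Suc j}. (-1) ^ i * f i * h i j)" .
    have "(\<Sum>i\<le>j. (-1) ^ i * f i * h i j) = (\<Sum>i\<le>j. (-1) ^ j * ((-1) ^ (j - i) * h i j * f i))"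
    proof (rule sum.cong)
      fix i assume "i \<in> {..j}"
      then have "j + (j - i) = i + 2 * (j - i)" by simp
      then have "(-1 :: 'a) ^ j * (-1) ^ (j - i) = (-1) ^ (i + 2 * (j - i))"
        by (metis power_add)
      then have "(-1 :: 'a) ^ j * (-1) ^ (j - i) = (-1) ^ i"
        by (simp add: power_add power_mult)
      then show "(-1) ^ i * f i * h i j = (-1) ^ j * ((-1) ^ (j - i) * h i j * f i)"
        by (metis (no_types, opaque_lifting) mult.assoc mult.commute)
    qed simp
    then have part: "(\<Sum>i\<le>j. (-1) ^ i * f i * h i j) = (-1) ^ j * f (Suc j)"
      by (simp add: fSuc sum_distrib_left)
    show ?thesis
    proof (cases "j = M")
      case True
      then have "{..<N} \<inter> {..Suc j} = {..j}" using Suc by auto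
      then show ?thesis using True eq part Suc by simp
    next
      case False
      then have "{..<N} \<inter> {..Suc j} = {..Suc j}" using j Suc by auto
      then show ?thesis using False eq part by (simp add: sub)
    qed
  qed
  \<comment> \<open>Deleting row 0 and column \<open>M\<close> moves the subdiagonal of ones onto
    the diagonal.\<close>
  define D where "D = mat_delete (U * H) 0 M"
  have entry: "(U * H) $$ (Suc i, j) = h (Suc i) j" if "Suc i < N" "j < N" for i j
  proof -
    have "(U * H) $$ (Suc i, j) = (\<Sum>k<N. (if Suc i = k then 1 else 0) * h k j)"
      using that by (simp add: U_def H_def scalar_prod_def atLeast0LessThan)
    also have "\<dots> = (\<Sum>k<N. if k = Suc i then h k j else 0)"
      by (rule sum.cong) auto
    also have "\<dots> = h (Suc i) j" using that by simp
    finally show ?thesis .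
  qed
  have D: "D \<in> carrier_mat M M"
    using H U Suc by (auto simp: D_def mat_delete_def)
  have dim: "dim_row (U * H) = Suc M" "dim_col (U * H) = Suc M"
    using H U Suc by auto
  have Dij: "D $$ (i, j) = h (Suc i) j" if "i < M" "j < M" for i j
    using that Suc entry[of i j] unfolding D_def mat_delete_def dim by simp
  have "upper_triangular D"
    using D by (auto simp: upper_triangular_def Dij zero)
  then have "det D = prod_list (diag_mat D)"
    using D by (rule det_upper_triangular)
  also have "\<dots> = 1"
    using D by (simp add: prod_list_diag_prod Dij sub)
  finally have detD: "det D = 1" .
  have UH: "U * H \<in> carrier_mat N N" using U H by simp
  have "det H = det (U * H)"
    using det_mult[OF U H] detU by simp
  also have "\<dots> = (\<Sum>j<N. (U * H) $$ (0, j) * cofactor (U * H) 0 j)"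
    using laplace_expansion_row[OF UH, of 0] Suc by simp
  also have "\<dots> = (\<Sum>j<N. if j = M then (-1) ^ M * f N * cofactor (U * H) 0 M else 0)"
    by (rule sum.cong) (auto simp: row0)
  also have "\<dots> = (-1) ^ M * f N * cofactor (U * H) 0 M"
    using Suc by simp
  also have "\<dots> = f N"
    using detD by (simp add: cofactor_def D_def[symmetric] flip: power_mult_distrib)
  finally show ?thesis by (simp add: H_def)
qed

section \<open>Vectors with bounded partial sums\<close>

text \<open>A weakly increasing sequence is encoded by its increments; \<open>x\<close> is its last
  term.\<close>

definition bounded_sums :: "(nat \<Rightarrow> nat) \<Rightarrow> nat \<Rightarrow> nat \<Rightarrow> (nat \<Rightarrow> nat) set" where
  "bounded_sums a k x = {\<alpha> \<in> {1..k} \<rightarrow>\<^sub>E UNIV. (\<forall>i\<in>{1..k}. sum \<alpha> {1..i} \<le> a i) \<and> sum \<alpha> {1..k} = x}"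

lemma bounded_sums_0: "bounded_sums a 0 x = (if x = 0 then {\<lambda>_. undefined} else {})"
  by (auto simp: bounded_sums_def)

lemma bounded_sums_empty: "a k < x \<Longrightarrow> bounded_sums a k x = {}"
  by (cases k) (auto simp: bounded_sums_0, force simp: bounded_sums_def simp del: sum.cl_ivl_Suc)

text \<open>Cutting off the last increment: \<open>y\<close> is the preceding partial sum, and the
  increment \<open>x - y\<close> is then forced.\<close>

lemma bij_betw_bounded_sums_Suc:
  assumes "x \<le> a (Suc k)"
  shows "bij_betw (\<lambda>(y, \<alpha>). \<alpha>(Suc k := x - y)) (SIGMA y:{..x}. bounded_sums a k y)
           (bounded_sums a (Suc k) x)"
proof (rule bij_betw_byWitness[where f' = "\<lambda>\<beta>. (sum \<beta> {1..k}, \<beta>(Suc k := undefined))"])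
  have upd: "sum (\<alpha>(Suc k := z)) {1..i} = sum \<alpha> {1..i}" if "i \<le> k" for \<alpha> :: "nat \<Rightarrow> nat" and z i
    using that by (intro sum.cong) auto
  have upd': "sum (\<alpha>(Suc k := z)) {Suc 0..i} = sum \<alpha> {Suc 0..i}" if "i \<le> k"
    for \<alpha> :: "nat \<Rightarrow> nat" and z i
    using upd[OF that] by simp
  show "\<forall>q\<in>SIGMA y:{..x}. bounded_sums a k y.
      (\<lambda>\<beta>. (sum \<beta> {1..k}, \<beta>(Suc k := undefined))) ((\<lambda>(y, \<alpha>). \<alpha>(Suc k := x - y)) q) = q"
    by (auto simp: bounded_sums_def upd' PiE_def extensional_def fun_eq_iff)
  show "\<forall>\<beta>\<in>bounded_sums a (Suc k) x.
      (\<lambda>(y, \<alpha>). \<alpha>(Suc k := x - y)) (sum \<beta> {1..k}, \<beta>(Suc k := undefined)) = \<beta>"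
    by (auto simp: bounded_sums_def fun_eq_iff)
  show "(\<lambda>(y, \<alpha>). \<alpha>(Suc k := x - y)) ` (SIGMA y:{..x}. bounded_sums a k y)
      \<subseteq> bounded_sums a (Suc k) x"
    using assms by (auto simp: bounded_sums_def upd' PiE_def extensional_def atLeastAtMostSuc_conv)
  show "(\<lambda>\<beta>. (sum \<beta> {1..k}, \<beta>(Suc k := undefined))) ` bounded_sums a (Suc k) x
      \<subseteq> (SIGMA y:{..x}. bounded_sums a k y)"
    by (auto simp: bounded_sums_def upd' PiE_def extensional_def)
qed

lemma finite_bounded_sums: "finite (bounded_sums a k x)"
proof (induction k arbitrary: x)
  case 0
  then show ?case by (simp add: bounded_sums_0)
next
  case (Suc k)
  show ?case
  proof (cases "x \<le> a (Suc k)")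
    case True
    show ?thesis
      using bij_betw_finite[OF bij_betw_bounded_sums_Suc[of x a k, OF True]] Suc by blast
  qed (simp add: bounded_sums_empty)
qed

lemma card_bounded_sums_Suc:
  assumes "x \<le> a (Suc k)"
  shows "card (bounded_sums a (Suc k) x) = (\<Sum>y\<le>x. card (bounded_sums a k y))"
  using bij_betw_same_card[OF bij_betw_bounded_sums_Suc[of x a k, OF assms]]
  by (simp add: finite_bounded_sums)

text \<open>This is \<open>f\<^sub>k\<close>: no last term exceeds \<open>a k\<close>. For
  \<open>k = 0\<close> only the empty vector counts, whatever \<open>a 0\<close> is.\<close>

definition num_bounded :: "(nat \<Rightarrow> nat) \<Rightarrow> nat \<Rightarrow> nat" where
  "num_bounded a k = (\<Sum>x\<le>a k. card (bounded_sums a k x))"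

lemma sum_bounded_sums_extend:
  fixes g :: "nat \<Rightarrow> nat"
  assumes "a k \<le> b"
  shows "(\<Sum>x\<le>b. card (bounded_sums a k x) * g x) = (\<Sum>x\<le>a k. card (bounded_sums a k x) * g x)"
  using assms by (intro sum.mono_neutral_right) (auto simp: bounded_sums_empty)

lemma sum_choose_atMost: "(\<Sum>x\<le>b. x choose r) = Suc b choose Suc r"
  using sum_choose_upper[of r b] by (simp add: atMost_atLeast0)

lemma sum_choose_lessThan: "(\<Sum>x<b. x choose r) = b choose Suc r"
  by (cases b) (simp_all add: lessThan_Suc_atMost sum_choose_atMost)

text \<open>The sums on the right are \<open>Y\<^sub>k\<^sub>+\<^sub>1\<close> and \<open>Y\<^sub>k\<close>, the last increasing term being \<open>x\<close>.\<close>

lemma num_bounded_mult_choose: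
  assumes "mono a"
  shows "(Suc (a (Suc k)) choose Suc r) * num_bounded a k =
    (\<Sum>x\<le>a (Suc k). card (bounded_sums a (Suc k) x) * (x choose r)) +
    (\<Sum>x\<le>a k. card (bounded_sums a k x) * (x choose Suc r))"
proof -
  define b where "b = a (Suc k)"
  define c where "c x = card (bounded_sums a k x)" for x
  have le: "a k \<le> b" using assms by (simp add: b_def mono_def)
  have "num_bounded a k = (\<Sum>y\<le>b. c y)"
    using sum_bounded_sums_extend[of a k b "\<lambda>_. 1", OF le] by (simp add: num_bounded_def c_def)
  \<comment> \<open>The product counts pairs of a last term \<open>y\<close> and a next term
    \<open>x\<close>, where \<open>x choose r\<close> is the number of strictly decreasing tails of
    length \<open>r\<close> below \<open>x\<close>.\<close>
  then have "(Suc b choose Suc r) * num_bounded a k = (\<Sum>y\<le>b. \<Sum>x\<le>b. c y * (x choose r))"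
    unfolding mult.commute[of _ "num_bounded a k"] sum_choose_atMost[symmetric]
    by (simp only: sum_product)
  \<comment> \<open>If \<open>y <= x\<close>, the increasing part extends by \<open>x\<close>; if
    \<open>x < y\<close>, then \<open>x\<close> joins the decreasing tail, which gets length
    \<open>Suc r\<close>.\<close>
  also have "\<dots> = (\<Sum>y\<le>b. (\<Sum>x\<in>{x. x \<le> b \<and> y \<le> x}. c y * (x choose r)) + c y * (y choose Suc r))"
  proof (rule sum.cong)
    fix y assume "y \<in> {..b}"
    then have "{..b} = {x. x \<le> b \<and> y \<le> x} \<union> {..<y}" by auto
    then have "(\<Sum>x\<le>b. c y * (x choose r)) =
        (\<Sum>x\<in>{x. x \<le> b \<and> y \<le> x} \<union> {..<y}. c y * (x choose r))" by simp
    also have "\<dots> = (\<Sum>x\<in>{x. x \<le> b \<and> y \<le> x}. c y * (x choose r)) + (\<Sum>x<y. c y * (x choose r))"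
      by (rule sum.union_disjoint) auto
    finally show "(\<Sum>x\<le>b. c y * (x choose r)) =
        (\<Sum>x\<in>{x. x \<le> b \<and> y \<le> x}. c y * (x choose r)) + c y * (y choose Suc r)"
      by (simp add: sum_choose_lessThan flip: sum_distrib_left)
  qed simp
  also have "\<dots> = (\<Sum>y\<le>b. \<Sum>x\<in>{x. x \<le> b \<and> y \<le> x}. c y * (x choose r)) +
      (\<Sum>y\<le>b. c y * (y choose Suc r))"
    by (rule sum.distrib)
  also have "(\<Sum>y\<le>b. \<Sum>x\<in>{x. x \<le> b \<and> y \<le> x}. c y * (x choose r)) =
      (\<Sum>x\<le>b. \<Sum>y\<in>{y. y \<le> b \<and> y \<le> x}. c y * (x choose r))"
    using sum.swap_restrict[of "{..b}" "{..b}" "\<lambda>y x. c y * (x choose r)" "\<lambda>y x. y \<le> x"] by simp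
  also have "\<dots> = (\<Sum>x\<le>b. card (bounded_sums a (Suc k) x) * (x choose r))"
  proof (rule sum.cong)
    fix x assume x: "x \<in> {..b}"
    then have "{y. y \<le> b \<and> y \<le> x} = {..x}" by auto
    then show "(\<Sum>y\<in>{y. y \<le> b \<and> y \<le> x}. c y * (x choose r)) =
        card (bounded_sums a (Suc k) x) * (x choose r)"
      using x by (simp add: card_bounded_sums_Suc b_def c_def sum_distrib_right)
  qed simp
  also have "(\<Sum>y\<le>b. c y * (y choose Suc r)) = (\<Sum>y\<le>a k. c y * (y choose Suc r))"
    unfolding c_def by (rule sum_bounded_sums_extend[of a k b, OF le])
  finally show ?thesis by (simp add: b_def c_def)
qed

lemma num_bounded_Suc:
  assumes "mono a"
  shows "int (num_bounded a (Suc j)) =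
    (\<Sum>i\<le>j. (-1) ^ (j - i) * int (Suc (a (Suc i)) choose Suc (j - i)) * int (num_bounded a i))"
proof -
  \<comment> \<open>Here \<open>N = Suc j\<close>. The ends of the telescope are
    \<open>Y 0 = 0\<close>, as the empty vector has total 0 and \<open>0 choose Suc j\<close>
    vanishes, and \<open>Y (Suc j)\<close>, where the tail is empty.\<close>
  define Y where "Y i = int (\<Sum>x\<le>a i. card (bounded_sums a i x) * (x choose (Suc j - i)))" for i
  have partial: "(\<Sum>i\<le>l. (-1) ^ (j - i) * int (Suc (a (Suc i)) choose Suc (j - i)) * int (num_bounded a i))
      = (-1) ^ (j - l) * Y (Suc l)" if "l \<le> j" for l
    using that
  proof (induction l)
    case 0
    have "Y 0 = 0"
      unfolding Y_def by (auto simp: bounded_sums_0 intro!: sum.neutral)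
    moreover have "int (Suc (a (Suc 0)) choose Suc j) * int (num_bounded a 0) = Y (Suc 0) + Y 0"
      using num_bounded_mult_choose[OF assms, of 0 j]
      unfolding Y_def of_nat_mult[symmetric] of_nat_add[symmetric] by simp
    ultimately show ?case by (simp add: mult.assoc)
  next
    case (Suc l)
    have X: "int (Suc (a (Suc (Suc l))) choose Suc (j - Suc l)) * int (num_bounded a (Suc l))
        = Y (Suc (Suc l)) + Y (Suc l)"
      using num_bounded_mult_choose[OF assms, of "Suc l" "j - Suc l"] Suc.prems
      unfolding Y_def of_nat_mult[symmetric] of_nat_add[symmetric] by (simp add: Suc_diff_Suc)
    have "j - l = Suc (j - Suc l)" using Suc.prems by simp
    then have "(-1) ^ (j - l) * Y (Suc l) = - ((-1) ^ (j - Suc l) * Y (Suc l))" by simp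
    then show ?case
      using Suc.IH Suc.prems X by (simp add: mult.assoc distrib_left del: binomial_Suc_Suc)
  qed
  have "Y (Suc j) = int (num_bounded a (Suc j))"
    by (simp add: Y_def num_bounded_def)
  then show ?thesis using partial[of j] by simp
qed

theorem num_bounded_det:
  assumes "mono a"
  shows "int (num_bounded a N) = det1 N (\<lambda>i j. binom (a i + 1) (int j - int i + 1))"
proof -
  define h where "h i j = binom (a (i + 1) + 1) (int (j + 1) - int (i + 1) + 1)" for i j
  have "det (mat N N (\<lambda>(i, j). h i j)) = int (num_bounded a N)"
  proof (rule det_hessenberg)
    show "int (num_bounded a 0) = 1"
      unfolding num_bounded_def by (simp add: bounded_sums_0 if_distrib[of card] cong: if_cong)
    show "int (num_bounded a (Suc j)) = (\<Sum>i\<le>j. (-1) ^ (j - i) * h i j * int (num_bounded a i))" for j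
      unfolding num_bounded_Suc[OF assms]
    proof (rule sum.cong)
      fix i assume "i \<in> {..j}"
      then have eq: "int (j + 1) - int (i + 1) + 1 = int (Suc (j - i))" by auto
      have "h i j = int (Suc (a (Suc i)) choose Suc (j - i))"
        unfolding h_def binom_def eq by (simp del: of_nat_Suc)
      then show "(-1) ^ (j - i) * int (Suc (a (Suc i)) choose Suc (j - i)) * int (num_bounded a i) =
          (-1) ^ (j - i) * h i j * int (num_bounded a i)" by simp
    qed simp
  \<comment> \<open>The lower index is 0 on the subdiagonal, giving 1, and negative further down,
    giving 0.\<close>
  qed (auto simp: h_def binom_def)
  then show ?thesis unfolding det1_def h_def by simp
qed

section \<open>The bracket numbers\<close>

text \<open>The quotient is the ceiling of \<open>i / t\<close>, a closed form for the number of the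
  length-\<open>t\<close> block containing \<open>i\<close>.\<close>

lemma ceiling_div_eq:
  fixes k t i :: nat
  assumes "0 < t" "(k - 1) * t < i" "i \<le> k * t"
  shows "(i + t - 1) div t = k"
proof -
  obtain l where k: "k = Suc l" using assms by (cases k) auto
  have "i + t - 1 = k * t + (i - 1 - l * t)" "i - 1 - l * t < t"
    using assms by (auto simp: k)
  then show ?thesis using assms(1) by simp
qed

text \<open>Entries are nonnegative, so a partial sum is at most the one at the end of its block.
  From block \<open>p\<close> on, the prescribed total gives the bound.\<close>

lemma bracket_set_eq_bounded_sums:
  assumes t: "0 < t" and p: "1 \<le> p"
  shows "bracket_set n t p = bounded_sums (\<lambda>i. (i + t - 1) div t * (n - t)) (Suc (p * t)) (p * (n - t))"
    (is "_ = ?S")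
proof (intro equalityI subsetI)
  fix \<alpha> assume \<alpha>: "\<alpha> \<in> bracket_set n t p"
  have total: "sum \<alpha> {1..Suc (p * t)} = p * (n - t)"
    using \<alpha> by (simp add: bracket_set_def)
  have "sum \<alpha> {1..i} \<le> (i + t - 1) div t * (n - t)" if i: "i \<in> {1..Suc (p * t)}" for i
  proof -
    define k where "k = (i + t - 1) div t"
    have "i + t - 1 < Suc k * t"
      unfolding k_def using t dividend_less_div_times[of t "i + t - 1"] by simp
    then have ik: "i \<le> k * t" by simp
    then have k1: "1 \<le> k" using i by (cases k) auto
    show ?thesis
    proof (cases "k < p")
      case True
      then have "sum \<alpha> {1..k * t} \<le> k * (n - t)"
        using \<alpha> k1 by (simp add: bracket_set_def)
      moreover have "sum \<alpha> {1..i} \<le> sum \<alpha> {1..k * t}"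
        using ik by (intro sum_mono2) auto
      ultimately show ?thesis by (simp add: k_def)
    next
      case False
      have "sum \<alpha> {1..i} \<le> sum \<alpha> {1..Suc (p * t)}"
        using i by (intro sum_mono2) auto
      also have "\<dots> \<le> k * (n - t)"
        unfolding total using False by simp
      finally show ?thesis by (simp add: k_def)
    qed
  qed
  then show "\<alpha> \<in> ?S"
    using \<alpha> total unfolding bounded_sums_def bracket_set_def by auto
next
  fix \<alpha> assume \<alpha>: "\<alpha> \<in> ?S"
  have "sum \<alpha> {1..k * t} \<le> k * (n - t)" if k: "k \<in> {1..p - 1}" for k
  proof -
    have "k * t \<in> {1..Suc (p * t)}"
      using k t by (auto intro!: le_SucI mult_le_mono1)
    then have "sum \<alpha> {1..k * t} \<le> (k * t + t - 1) div t * (n - t)"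
      using \<alpha> unfolding bounded_sums_def by blast
    moreover have "(k * t + t - 1) div t = k"
      using k t by (intro ceiling_div_eq) auto
    ultimately show ?thesis by simp
  qed
  then show "\<alpha> \<in> bracket_set n t p"
    using \<alpha> unfolding bounded_sums_def bracket_set_def by auto
qed

lemma bracket_det:
  assumes t: "0 < t" and p: "1 \<le> p"
    and a: "\<forall>k \<in> {1..p}. \<forall>i \<in> {(k - 1) * t<..k * t}. a i = k * (n - t)"
  shows "int (bracket n t p) = det1 (p * t) (\<lambda>i j. binom (a i + 1) (int j - int i + 1))"
proof -
  \<comment> \<open>\<open>a\<close> is prescribed only on \<open>{1..p * t}\<close>;
    \<open>b\<close> agrees with it there and is monotone everywhere.\<close>
  define b where "b i = (i + t - 1) div t * (n - t)" for i
  have "mono b"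
    unfolding b_def by (intro monoI mult_le_mono1 div_le_mono) simp
  have bN: "b (p * t) = p * (n - t)"
    using ceiling_div_eq[of t p "p * t"] t p by (simp add: b_def)
  then have "p * (n - t) \<le> b (Suc (p * t))"
    using \<open>mono b\<close> by (metis le_SucI monoD order_refl)
  \<comment> \<open>The total forces the last entry. Dropping it leaves vectors of length
    \<open>p * t\<close> with any total up to \<open>p * (n - t)\<close>, which is
    \<open>b (p * t)\<close>.\<close>
  then have "bracket n t p = num_bounded b (p * t)"
    unfolding bracket_def bracket_set_eq_bounded_sums[OF t p] b_def[abs_def, symmetric]
    by (simp add: card_bounded_sums_Suc num_bounded_def bN)
  moreover have "a i = b i" if i: "i \<in> {1..p * t}" for i
  proof -
    \<comment> \<open>Blocks are counted from 0 here, so \<open>i\<close> lies in block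
      \<open>Suc l\<close> of the statement.\<close>
    define l where "l = (i - 1) div t"
    have l: "l * t \<le> i - 1" "i - 1 < Suc l * t"
      unfolding l_def using t dividend_less_div_times[of t "i - 1"] by auto
    have "i - 1 < p * t" using i by auto
    then have "l * t < p * t" using l(1) by (rule le_less_trans[rotated])
    then have "Suc l \<in> {1..p}" using t by simp
    moreover have "i \<in> {(Suc l - 1) * t<..Suc l * t}" using l i by auto
    ultimately show ?thesis
      using a[rule_format, of "Suc l" i] ceiling_div_eq[of t "Suc l" i] t by (simp add: b_def)
  qed
  then have "det1 (p * t) (\<lambda>i j. binom (a i + 1) (int j - int i + 1)) =
      det1 (p * t) (\<lambda>i j. binom (b i + 1) (int j - int i + 1))"
    unfolding det1_def by (intro arg_cong[where f = det] eq_matI) auto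
  ultimately show ?thesis
    using num_bounded_det[OF \<open>mono b\<close>] by simp
qed

text \<open>The second part is the first with \<open>n - t\<close> in place of \<open>t\<close>,
  since \<open>n - (n - t) = t\<close>.\<close>

theorem corollary5:
  fixes n t p :: nat and a a' :: "nat \<Rightarrow> nat"
  assumes "1 \<le> t" and "t < n" and "1 \<le> p"
    and "\<forall>k \<in> {1..p}. \<forall>i \<in> {(k - 1) * t<..k * t}. a i = k * (n - t)"
    and "\<forall>k \<in> {1..p}. \<forall>i \<in> {(k - 1) * (n - t)<..k * (n - t)}. a' i = k * t"
  shows "int (bracket n t p) =
           det1 (p * t) (\<lambda>i j. binom (a i + 1) (int j - int i + 1)) \<and>
         int (bracket n (n - t) p) =
           det1 (p * (n - t)) (\<lambda>i j. binom (a' i + 1) (int j - int i + 1))"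
  using assms bracket_det[of t p a n] bracket_det[of "n - t" p a' n] by simp

end
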